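(* For any integer $t \ge 0$, each of the four X-trees (i) $\mathrm{X}(7 + 12t,\ 6 + 12t,\ 3 + 12t,\ 1)$, (ii) $\mathrm{X}(9 + 12t,\ 8 + 12t,\ 5 + 12t,\ 3)$, (iii) $\mathrm{X}(10 + 12t,\ 9 + 12t,\ 6 + 12t,\ 2)$, (iv) $\mathrm{X}(11 + 12t,\ 10 + 12t,\ 7 + 12t,\ 1)$ is transmission irregular.
   Context: For a simple connected graph $G$, the transmission of a vertex $u$ is $\mathrm{Tr}_G(u) = \sum_{v \in V(G)} d_G(u,v)$, where $d_G$ is the graph distance. $G$ is transmission irregular if all its vertices have mutually distinct transmissions. For positive integers $A_1, A_2, A_3, A_4$, the X-tree $\mathrm{X}(A_1, A_2, A_3, A_4)$ is the starlike tree with four branches of these lengths, i.e. the tree with a single vertex $u$ of degree greater than two, where $u$ has degree $4$ and the four pendent paths starting at $u$ have lengths (numbers of edges) $A_1, A_2, A_3, A_4$. *)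

theory Defs
  imports "Graph_Theory.Graph_Theory"
begin

text \<open>
  Finite simple graphs are the finite, loop-free, symmetric digraphs without parallel arcs of
  the locale \<^locale>\<open>graph\<close>; each undirected edge is a pair of opposite arcs.
  With unit weights, the \<open>\<mu>\<close> of the shortest path theory is the graph distance.
\<close>

definition transmission :: "('a, 'b) pre_digraph \<Rightarrow> 'a \<Rightarrow> ereal" where
  "transmission G u = (\<Sum>v\<in>verts G. wf_digraph.\<mu> G (\<lambda>_. 1) u v)"

definition transmission_irregular :: "('a, 'b) pre_digraph \<Rightarrow> bool" where
  "transmission_irregular G \<longleftrightarrow>
     graph G \<and> connected G \<and> inj_on (transmission G) (verts G)"

text \<open>
  The vertex of branch \<open>i\<close> at distance \<open>j\<close> from the centre; the starting points of all branches
  are identified with the centre \<open>(0, 0)\<close>.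
\<close>

definition branch_vertex :: "nat \<Rightarrow> nat \<Rightarrow> nat \<times> nat" where
  "branch_vertex i j = (if j = 0 then (0, 0) else (i, j))"

definition starlike_edges :: "nat list \<Rightarrow> ((nat \<times> nat) \<times> (nat \<times> nat)) set" where
  "starlike_edges As =
     {(branch_vertex i j, branch_vertex i (Suc j)) | i j. i < length As \<and> j < As ! i}"

text \<open>The tree consisting of paths of lengths (numbers of edges) \<open>As\<close> glued at one end.\<close>

definition starlike_tree ::
    "nat list \<Rightarrow> (nat \<times> nat, (nat \<times> nat) \<times> (nat \<times> nat)) pre_digraph" where
  "starlike_tree As = with_proj
     \<lparr> pverts = insert (0, 0) {branch_vertex i j | i j. i < length As \<and> j \<le> As ! i},
       parcs = starlike_edges As \<union> (starlike_edges As)\<inverse> \<rparr>"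

definition X_tree ::
    "nat \<Rightarrow> nat \<Rightarrow> nat \<Rightarrow> nat \<Rightarrow> (nat \<times> nat, (nat \<times> nat) \<times> (nat \<times> nat)) pre_digraph" where
  "X_tree A1 A2 A3 A4 = starlike_tree [A1, A2, A3, A4]"

lemma unit_weight_dist:
  assumes "wf_digraph G"
  shows "wf_digraph.\<mu> G (\<lambda>_. 1) u v = (INF p\<in>{p. pre_digraph.awalk G u p v}. ereal (length p))"
proof -
  interpret wf_digraph G by fact
  show ?thesis
    by (simp add: \<mu>_def awalk_cost_def sum_list_triv)
qed

lemma starlike_edges_alt:
  "starlike_edges As = (\<lambda>(i, j). (branch_vertex i j, branch_vertex i (Suc j))) `
     (SIGMA i:{..<length As}. {..<As ! i})"
  by (auto simp: starlike_edges_def image_def)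

lemma finite_starlike_edges: "finite (starlike_edges As)"
  by (simp add: starlike_edges_alt)

lemma verts_starlike_tree:
  "verts (starlike_tree As) = insert (0, 0) (SIGMA i:{..<length As}. {1..As ! i})"
proof (intro equalityI subsetI)
  fix v assume "v \<in> verts (starlike_tree As)"
  then show "v \<in> insert (0, 0) (SIGMA i:{..<length As}. {1..As ! i})"
    by (auto simp: starlike_tree_def branch_vertex_def split: if_splits)
next
  fix v assume "v \<in> insert (0, 0) (SIGMA i:{..<length As}. {1..As ! i})"
  then consider "v = (0, 0)"
    | i j where "i < length As" "1 \<le> j" "j \<le> As ! i" "v = (i, j)" by auto
  then show "v \<in> verts (starlike_tree As)"
  proof cases
    case 2
    then have "v = branch_vertex i j" by (simp add: branch_vertex_def)
    with 2 have "\<exists>i j. v = branch_vertex i j \<and> i < length As \<and> j \<le> As ! i" by blast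
    then show ?thesis by (simp add: starlike_tree_def)
  qed (simp add: starlike_tree_def)
qed

lemma arcs_starlike_tree:
  "arcs (starlike_tree As) = starlike_edges As \<union> (starlike_edges As)\<inverse>"
  by (simp add: starlike_tree_def)

lemma graph_starlike_tree: "graph (starlike_tree As)"
proof -
  have "pair_graph
     \<lparr> pverts = verts (starlike_tree As), parcs = arcs (starlike_tree As) \<rparr>"
    by unfold_locales
      (auto simp: verts_starlike_tree arcs_starlike_tree finite_starlike_edges
        symmetric_def sym_def, auto simp: starlike_edges_def branch_vertex_def split: if_splits)
  then interpret G: pair_graph
    "\<lparr> pverts = verts (starlike_tree As), parcs = arcs (starlike_tree As) \<rparr>" .
  have "with_proj \<lparr> pverts = verts (starlike_tree As), parcs = arcs (starlike_tree As) \<rparr>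
      = starlike_tree As"
    by (simp add: starlike_tree_def with_proj_def)
  with G.graph_axioms show ?thesis by simp
qed

text \<open>Together with connectedness, the following count says that the graph is a tree.\<close>

lemma card_starlike_edges:
  "card (starlike_edges As) + 1 = card (verts (starlike_tree As))"
proof -
  have "inj_on (\<lambda>(i, j). (branch_vertex i j, branch_vertex i (Suc j)))
      (SIGMA i:{..<length As}. {..<As ! i})"
    by (intro inj_onI) (clarsimp simp: branch_vertex_def)
  then have "card (starlike_edges As) = (\<Sum>i<length As. As ! i)"
    by (simp add: starlike_edges_alt card_image)
  moreover have "card (verts (starlike_tree As)) = Suc (\<Sum>i<length As. As ! i)"
    by (subst verts_starlike_tree, subst card_insert_disjoint) auto
  ultimately show ?thesis by simp
qed

lemma out_arcs_starlike_tree: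
  "out_arcs (starlike_tree As) u = Pair u ` {v. (u, v) \<in> arcs (starlike_tree As)}"
  by (auto simp: out_arcs_def starlike_tree_def)

lemma degree_centre_starlike_tree:
  assumes "\<And>a. a \<in> set As \<Longrightarrow> a > 0"
  shows "out_degree (starlike_tree As) (0, 0) = length As"
proof -
  have "{v. ((0, 0), v) \<in> arcs (starlike_tree As)} = (\<lambda>i. (i, 1)) ` {..<length As}"
    (is "?N = ?M")
  proof (intro equalityI subsetI)
    fix v assume "v \<in> ?N"
    then show "v \<in> ?M"
      by (auto simp: arcs_starlike_tree starlike_edges_def branch_vertex_def split: if_splits)
  next
    fix v assume "v \<in> ?M"
    then obtain i where i: "i < length As" "v = (i, 1)" by auto
    then have "As ! i > 0"
      using assms by simp
    then have "(branch_vertex i 0, branch_vertex i (Suc 0)) \<in> starlike_edges As"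
      unfolding starlike_edges_def using i by blast
    then show "v \<in> ?N"
      using i by (simp add: arcs_starlike_tree branch_vertex_def)
  qed
  then show ?thesis
    by (simp add: out_degree_def out_arcs_starlike_tree card_image inj_on_def)
qed

lemma degree_branch_starlike_tree:
  assumes "u \<noteq> (0, 0)"
  shows "out_degree (starlike_tree As) u \<le> 2"
proof -
  obtain i j where u: "u = (i, j)" by (cases u)
  have "{v. (u, v) \<in> arcs (starlike_tree As)}
      \<subseteq> {branch_vertex i (j - 1), branch_vertex i (Suc j)}"
    using assms
    by (auto simp: u arcs_starlike_tree starlike_edges_def branch_vertex_def split: if_splits)
  then have "card {v. (u, v) \<in> arcs (starlike_tree As)}
      \<le> card {branch_vertex i (j - 1), branch_vertex i (Suc j)}"
    by (intro card_mono) auto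
  also have "\<dots> \<le> 2"
    by (simp add: card_insert_if)
  finally show ?thesis
    by (simp add: out_degree_def out_arcs_starlike_tree card_image inj_on_def)
qed

end

theory Submission
  imports Defs
begin

text \<open>
  In a tree, moving one step away from the centre along a branch of length \<open>a\<close>, onto its \<open>j\<close>-th
  vertex, brings the \<open>a - j + 1\<close> vertices from there to the tip closer by one, and all the others
  get farther by one. Summing these steps, the transmission of the \<open>j\<close>-th vertex exceeds that
  of the centre by \<open>j * (j + (S - 2 * a))\<close>, where \<open>S\<close> is the number of edges
  (\<open>transmission_starlike_tree\<close>). Call \<open>S - 2 * a\<close> the offset of the branch. When no branch
  contains more than half of the edges, the offsets are nonnegative and transmissions increase
  strictly along each branch, so irregularity only asks that two different branches share no value
  \<open>j * (j + offset)\<close> with \<open>j > 0\<close> (\<open>transmission_irregular_starlike_treeI\<close>).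

  All four families have the shape \<open>X(A + 4, A + 3, A, B)\<close>. With \<open>c = A + B - 1\<close> the offsets of the
  three long branches are \<open>c\<close>, \<open>c + 2\<close> and \<open>c + 8\<close>. Completing squares turns a coincidence between
  offsets \<open>c\<close> and \<open>c + 2 * d\<close> into \<open>(j + k + c + d) * (k - j + d) = d * (c + d)\<close>. The second factor
  must then lie strictly between \<open>0\<close> and \<open>d\<close> (\<open>equal_offsets_cases\<close>), and each of its few possible
  values is excluded by parity, by \<open>4 dvd A + B\<close>, by \<open>\<not> 3 dvd A + B\<close>, or because \<open>j\<close> would overshoot
  the end of its branch.

  The offset of the branch of length \<open>B\<close> is about \<open>3 * c\<close>, which makes its \<open>k\<close>-th vertex comparable
  only with vertices at positions \<open>j < 3 * k\<close> of the long branches. As \<open>B \<le> 3\<close>, finitely many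
  equations, linear in \<open>t\<close>, remain, and none of them has a solution in natural numbers
  (\<open>short_branch_distinct\<close>).
\<close>

section \<open>Distances in starlike trees\<close>

text \<open>
  A function that drops by at most one along each arc and vanishes at \<open>v\<close> bounds the length of
  every walk to \<open>v\<close> from below; following arcs along which it drops by exactly one produces a walk
  attaining the bound. This identifies a guessed distance function without reasoning about
  shortest paths.
\<close>

lemma unit_weight_dist_eqI:
  fixes f :: "'a \<Rightarrow> nat"
  assumes "wf_digraph G" "u \<in> verts G" "v \<in> verts G" "f v = 0"
    and lipschitz: "\<And>e. e \<in> arcs G \<Longrightarrow> f (tail G e) \<le> Suc (f (head G e))"
    and descent: "\<And>x. x \<in> verts G \<Longrightarrow> x \<noteq> v \<Longrightarrow>
      \<exists>e\<in>arcs G. tail G e = x \<and> f x = Suc (f (head G e))"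
  shows "wf_digraph.\<mu> G (\<lambda>_. 1) u v = ereal (real (f u))"
proof -
  interpret wf_digraph G by fact
  have lower: "f x \<le> length p" if "awalk x p v" for x p
    using that
  proof (induction p arbitrary: x)
    case Nil
    then show ?case using \<open>f v = 0\<close> by (simp add: awalk_Nil_iff)
  next
    case (Cons e p)
    then have "e \<in> arcs G" "x = tail G e" "f (head G e) \<le> length p"
      by (auto simp: awalk_Cons_iff)
    then show ?case using lipschitz[of e] by simp
  qed
  have upper: "\<exists>p. awalk x p v \<and> length p = f x" if "x \<in> verts G" for x
    using that
  proof (induction "f x" arbitrary: x)
    case 0
    then have "x = v" using descent[of x] by force
    then show ?case using 0 by (auto simp: awalk_Nil_iff intro!: exI[of _ "[]"])
  next
    case (Suc n)
    then have "x \<noteq> v" using \<open>f v = 0\<close> by auto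
    then obtain e where e: "e \<in> arcs G" "tail G e = x" "f x = Suc (f (head G e))"
      using descent Suc.prems by blast
    then obtain p where "awalk (head G e) p v" "length p = f (head G e)"
      using Suc.hyps(1)[of "head G e"] Suc.hyps(2) by auto
    then show ?case
      using e by (intro exI[of _ "e # p"]) (auto simp: awalk_Cons_iff)
  qed
  obtain p where "awalk u p v" "length p = f u" using upper[OF \<open>u \<in> verts G\<close>] by blast
  then show ?thesis
    unfolding unit_weight_dist[OF \<open>wf_digraph G\<close>]
    by (intro antisym INF_lower2[of p] INF_greatest) (auto dest: lower)
qed

text \<open>
  The centre is labelled as position \<open>0\<close> of branch \<open>0\<close>. This does no harm, because both cases give
  \<open>snd v\<close> when \<open>u\<close> is the centre.
\<close>

definition starlike_dist :: "nat \<times> nat \<Rightarrow> nat \<times> nat \<Rightarrow> nat" where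
  "starlike_dist u v =
     (if fst u = fst v then (snd u - snd v) + (snd v - snd u) else snd u + snd v)"

lemma starlike_dist_arc:
  assumes "e \<in> arcs (starlike_tree As)"
  shows "starlike_dist (tail (starlike_tree As) e) v \<le>
    Suc (starlike_dist (head (starlike_tree As) e) v)"
  using assms
  by (cases v) (auto simp: starlike_tree_def starlike_edges_def branch_vertex_def starlike_dist_def
      split: if_splits)

lemma starlike_dist_descent:
  assumes "u \<in> verts (starlike_tree As)" "v \<in> verts (starlike_tree As)" "u \<noteq> v"
  shows "\<exists>e\<in>arcs (starlike_tree As). tail (starlike_tree As) e = u \<and>
    starlike_dist u v = Suc (starlike_dist (head (starlike_tree As) e) v)"
proof -
  obtain i j i' j' where uv: "u = (i, j)" "v = (i', j')" by (cases u, cases v)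
  have edge: "(branch_vertex a b, branch_vertex a (Suc b)) \<in> starlike_edges As"
    if "a < length As" "b < As ! a" for a b
    using that by (auto simp: starlike_edges_def)
  \<comment> \<open>From the centre, or from a vertex below \<open>v\<close> on its branch, step outwards along the
    branch of \<open>v\<close>; otherwise step towards the centre.\<close>
  consider "j = 0" | "i = i'" "0 < j" "j < j'" | "0 < j" "\<not> (i = i' \<and> j < j')" by blast
  then have "\<exists>y. (u, y) \<in> arcs (starlike_tree As) \<and>
    starlike_dist u v = Suc (starlike_dist y v)"
  proof cases
    case 1
    with assms uv have "u = (0, 0)" "i' < length As" "0 < j'" "j' \<le> As ! i'"
      by (auto simp: verts_starlike_tree)
    then show ?thesis
      using edge[of i' 0] uv
      by (intro exI[of _ "(i', 1)"])
        (auto simp: arcs_starlike_tree branch_vertex_def starlike_dist_def)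
  next
    case 2
    then show ?thesis
      using edge[of i j] uv assms
      by (intro exI[of _ "(i, Suc j)"])
        (auto simp: verts_starlike_tree arcs_starlike_tree branch_vertex_def starlike_dist_def)
  next
    case 3
    then have "(branch_vertex i (j - 1), u) \<in> starlike_edges As"
      using edge[of i "j - 1"] uv assms
      by (auto simp: verts_starlike_tree branch_vertex_def split: if_splits)
    then show ?thesis
      using 3 uv assms
      by (intro exI[of _ "branch_vertex i (j - 1)"])
        (auto simp: verts_starlike_tree arcs_starlike_tree branch_vertex_def starlike_dist_def
          split: if_splits)
  qed
  then obtain y where "(u, y) \<in> arcs (starlike_tree As)"
    "starlike_dist u v = Suc (starlike_dist y v)" by blast
  then show ?thesis
    by (intro bexI[of _ "(u, y)"]) (auto simp: starlike_tree_def)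
qed

lemma unit_weight_dist_starlike_tree:
  assumes "u \<in> verts (starlike_tree As)" "v \<in> verts (starlike_tree As)"
  shows "wf_digraph.\<mu> (starlike_tree As) (\<lambda>_. 1) u v = ereal (real (starlike_dist u v))"
proof -
  interpret graph "starlike_tree As" by (rule graph_starlike_tree)
  show ?thesis
    using assms starlike_dist_arc starlike_dist_descent
    by (intro unit_weight_dist_eqI[where f = "\<lambda>x. starlike_dist x v"])
      (auto simp: starlike_dist_def[of v v] wf_digraph_axioms)
qed

lemma connected_starlike_tree: "connected (starlike_tree As)"
proof -
  interpret graph "starlike_tree As" by (rule graph_starlike_tree)
  have "u \<rightarrow>\<^sup>*\<^bsub>starlike_tree As\<^esub> v"
    if "u \<in> verts (starlike_tree As)" "v \<in> verts (starlike_tree As)" for u v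
  proof -
    have "\<mu> (\<lambda>_. 1) u v < \<infinity>"
      using unit_weight_dist_starlike_tree[OF that] by simp
    then show ?thesis by (metis \<mu>_reach_conv)
  qed
  then have "strongly_connected (mk_symmetric (starlike_tree As))"
    by (intro strongly_connectedI) (auto simp: verts_starlike_tree intro: reachable_mk_symmetricI)
  then show ?thesis by (simp add: connected_def)
qed

section \<open>Transmissions in starlike trees\<close>

text \<open>
  On the path with vertices \<open>0, \<dots>, n\<close>, replace the distances \<open>k\<close> to the end \<open>0\<close> by those to \<open>j\<close>. The
  vertices \<open>1, \<dots>, j\<close> change the sum by \<open>j * j - j * (j + 1) = - j\<close>, and each of the \<open>n - j\<close>
  vertices beyond changes it by \<open>- j\<close>. The centre itself is not counted, since it is shared by all
  branches.
\<close>

lemma sum_dist_on_path: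
  fixes j n :: nat
  assumes "j \<le> n"
  shows "(\<Sum>k=1..n. int ((j - k) + (k - j))) =
    (\<Sum>k=1..n. int k) + int j * (int j - int n - 1)"
  using assms
proof (induction rule: dec_induct)
  case base
  have "(\<Sum>k=1..j. int ((j - k) + (k - j))) = (\<Sum>k=1..j. int j - int k)"
    by (intro sum.cong) auto
  also have "\<dots> = int j * int j - (\<Sum>k=1..j. int k)"
    by (simp add: sum_subtractf)
  also have "\<dots> = (\<Sum>k=1..j. int k) + int j * int j - 2 * (\<Sum>k=1..j. int k)"
    by simp
  also have "2 * (\<Sum>k=1..j. int k) = int j * (int j + 1)"
    by (induction j) (auto simp: algebra_simps)
  finally show ?case by (simp add: algebra_simps)
next
  case (step n)
  then show ?case by (auto simp: algebra_simps)
qed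

text \<open>
  Relative to the centre, a vertex of another branch is farther by \<open>j\<close>, so that the branch
  \<open>l\<close> adds \<open>j * As ! l\<close>; the own branch is treated by the path sum above. The double sum is the
  transmission of the centre, and the second summand is the excess over it.
\<close>

lemma transmission_starlike_tree:
  assumes "i < length As" "j \<le> As ! i"
  shows "transmission (starlike_tree As) (branch_vertex i j) =
    ereal (real_of_int ((\<Sum>l<length As. \<Sum>k=1..As ! l. int k) +
      int j * (int j + int (sum_list As) - 2 * int (As ! i))))"
proof -
  let ?u = "branch_vertex i j" and ?V = "verts (starlike_tree As)"
  let ?B = "SIGMA l:{..<length As}. {1..As ! l}"
  have u: "?u \<in> ?V"
    using assms by (auto simp: verts_starlike_tree branch_vertex_def)
  have dist: "starlike_dist ?u (l, k) =
    (if l = i then (j - k) + (k - j) else j + k)" for l k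
    by (auto simp: branch_vertex_def starlike_dist_def)
  have branch: "(\<Sum>k=1..As ! l. int (starlike_dist ?u (l, k))) =
     (\<Sum>k=1..As ! l. int k) + int j * int (As ! l) +
       (if l = i then int j * (int j - 2 * int (As ! i) - 1) else 0)" for l
  proof (cases "l = i")
    case True
    then show ?thesis
      using sum_dist_on_path[OF assms(2)] by (simp add: dist algebra_simps)
  next
    case False
    then show ?thesis by (simp add: dist sum.distrib)
  qed
  have "(\<Sum>v\<in>?V. int (starlike_dist ?u v)) =
      int (starlike_dist ?u (0, 0)) + (\<Sum>v\<in>?B. int (starlike_dist ?u v))"
    unfolding verts_starlike_tree by (rule sum.insert) auto
  also have "int (starlike_dist ?u (0, 0)) = int j"
    by (auto simp: branch_vertex_def starlike_dist_def)
  also have "(\<Sum>v\<in>?B. int (starlike_dist ?u v)) =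
      (\<Sum>l<length As. \<Sum>k=1..As ! l. int (starlike_dist ?u (l, k)))"
    by (subst sum.Sigma) auto
  also have "\<dots> = (\<Sum>l<length As. \<Sum>k=1..As ! l. int k) + int j * int (sum_list As) +
      int j * (int j - 2 * int (As ! i) - 1)"
    unfolding branch using assms
    by (simp add: sum.distrib sum.delta sum_list_sum_nth atLeast0LessThan flip: sum_distrib_left)
  finally have total: "(\<Sum>v\<in>?V. int (starlike_dist ?u v)) =
      (\<Sum>l<length As. \<Sum>k=1..As ! l. int k) +
      int j * (int j + int (sum_list As) - 2 * int (As ! i))"
    by (simp add: algebra_simps)
  have "transmission (starlike_tree As) ?u = (\<Sum>v\<in>?V. ereal (real (starlike_dist ?u v)))"
    unfolding transmission_def by (intro sum.cong refl unit_weight_dist_starlike_tree u)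
  also have "\<dots> = ereal (real_of_int (\<Sum>v\<in>?V. int (starlike_dist ?u v)))"
    by simp
  finally show ?thesis unfolding total .
qed

text \<open>
  The half-size condition makes all offsets nonnegative. Hence the excess is strictly increasing
  along each branch and positive away from the centre, which leaves only pairs of noncentral
  vertices on different branches to be compared.
\<close>

lemma transmission_irregular_starlike_treeI:
  assumes "As \<noteq> []"
    and half: "\<And>i. i < length As \<Longrightarrow> 2 * As ! i \<le> sum_list As"
    and distinct: "\<And>i i' j k. i < i' \<Longrightarrow> i' < length As \<Longrightarrow>
      j \<in> {1..As ! i} \<Longrightarrow> k \<in> {1..As ! i'} \<Longrightarrow>
      j * (j + (sum_list As - 2 * As ! i)) \<noteq> k * (k + (sum_list As - 2 * As ! i'))"
  shows "transmission_irregular (starlike_tree As)"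
proof -
  define g where "g i j = j * (j + (sum_list As - 2 * As ! i))" for i j
  have int_g: "int (g i j) = int j * (int j + int (sum_list As) - 2 * int (As ! i))"
    if "i < length As" for i j
    using half[OF that] by (simp add: g_def of_nat_diff)
  have trans_eq: "g i j = g i' k"
    if "transmission (starlike_tree As) (branch_vertex i j) =
        transmission (starlike_tree As) (branch_vertex i' k)"
      "i < length As" "j \<le> As ! i" "i' < length As" "k \<le> As ! i'" for i j i' k
  proof -
    have "int (g i j) = int (g i' k)"
      using that(1)
      unfolding transmission_starlike_tree[OF that(2,3)] transmission_starlike_tree[OF that(4,5)]
        int_g[OF that(2)] int_g[OF that(4)]
      by (simp only: ereal.inject of_int_eq_iff add_left_cancel)
    then show ?thesis by simp
  qed
  have strict: "g i j < g i k" if "j < k" for i j k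
    using that unfolding g_def by (intro mult_strict_mono) auto
  have pos: "0 < g i j" if "0 < j" for i j
    using that by (simp add: g_def)
  have inj: "branch_vertex i j = branch_vertex i' k"
    if "g i j = g i' k" "i < length As" "j \<le> As ! i" "i' < length As" "k \<le> As ! i'" for i j i' k
  proof (cases "j = 0 \<or> k = 0")
    case True
    then have "j = 0" "k = 0" using that(1) pos by (metis g_def mult_0 neq0_conv)+
    then show ?thesis by (simp add: branch_vertex_def)
  next
    case False
    have "i = i'"
      using distinct[of i i' j k] distinct[of i' i k j] that False
      by (cases i i' rule: linorder_cases) (auto simp: g_def)
    moreover have "j = k"
      using strict[of j k i] strict[of k j i] that(1) \<open>i = i'\<close>
      by (cases j k rule: linorder_cases) auto
    ultimately show ?thesis by simp
  qed
  have vertex: "\<exists>i j. u = branch_vertex i j \<and> i < length As \<and> j \<le> As ! i"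
    if "u \<in> verts (starlike_tree As)" for u
    using that \<open>As \<noteq> []\<close>
    by (intro exI[of _ "fst u"] exI[of _ "snd u"])
      (auto simp: verts_starlike_tree branch_vertex_def)
  have "inj_on (transmission (starlike_tree As)) (verts (starlike_tree As))"
  proof (rule inj_onI)
    fix u v
    assume "u \<in> verts (starlike_tree As)" "v \<in> verts (starlike_tree As)"
      and eq: "transmission (starlike_tree As) u = transmission (starlike_tree As) v"
    then obtain i j i' k where
      u: "u = branch_vertex i j" "i < length As" "j \<le> As ! i" and
      v: "v = branch_vertex i' k" "i' < length As" "k \<le> As ! i'"
      using vertex by meson
    show "u = v"
      using inj[OF trans_eq[OF eq[unfolded u(1) v(1)] u(2,3) v(2,3)] u(2,3) v(2,3)] u(1) v(1)
      by simp
  qed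
  then show ?thesis
    by (simp add: transmission_irregular_def graph_starlike_tree connected_starlike_tree)
qed

section \<open>The arithmetic of the four families\<close>

text \<open>
  Multiplied by four, the hypothesis equates two differences of squares,
  \<open>(2 j + c)\<^sup>2 - c\<^sup>2 = (2 k + c + 2 d)\<^sup>2 - (c + 2 d)\<^sup>2\<close>, which factorises as stated.
  Since the cofactor \<open>j + k + c + d\<close> exceeds \<open>c + d\<close>, the factor \<open>q = k - j + d\<close> is less than \<open>d\<close>.
\<close>

lemma equal_offsets_cases:
  fixes c d j k :: nat
  assumes "0 < d" "0 < j" "j * (j + c) = k * (k + (c + 2 * d))"
  obtains q where "0 < q" "q < d" "k + d = j + q" "q * (j + k + c + d) = d * (c + d)"
proof -
  define q where "q = int k - int j + int d"
  have "int j * (int j + int c) = int k * (int k + (int c + 2 * int d))"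
    using arg_cong[OF assms(3), of int] by simp
  then have fact: "q * (int j + int k + int c + int d) = int d * (int c + int d)"
    by (simp add: q_def algebra_simps)
  have "0 < int d * (int c + int d)" using assms(1) by simp
  then have "0 < q" unfolding fact[symmetric] using assms(2) by (simp add: zero_less_mult_iff)
  have "q < int d"
  proof (rule ccontr)
    assume "\<not> q < int d"
    then have "int d * (int c + int d) < q * (int j + int k + int c + int d)"
      using assms(1,2) by (intro mult_le_less_imp_less) auto
    then show False using fact by simp
  qed
  show thesis
  proof (rule that[of "nat q"])
    have "int (nat q * (j + k + c + d)) = int (d * (c + d))"
      using \<open>0 < q\<close> fact by simp
    then show "nat q * (j + k + c + d) = d * (c + d)" by (simp only: of_nat_eq_iff)
  qed (use \<open>0 < q\<close> \<open>q < int d\<close> in \<open>auto simp: q_def\<close>)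
qed

text \<open>
  The lengths \<open>A + 4, A + 3, A\<close> are chosen so that the offsets of the long branches are \<open>c\<close>, \<open>c + 2\<close>
  and \<open>c + 8\<close>. The first two branches never clash; the first and the third are separated by
  \<open>\<not> 3 dvd A + B\<close> and the parity of \<open>A + B\<close>; the second and the third by \<open>4 dvd A + B\<close>. For
  the branch of length \<open>B\<close> only positions \<open>j < 3 * k\<close> are left to be checked.
\<close>

lemma transmission_irregular_X_treeI:
  fixes A B :: nat
  assumes "0 < A" "0 < B" "4 dvd A + B" "\<not> 3 dvd A + B"
    and short: "\<And>j k s. k \<in> {1..B} \<Longrightarrow> 0 < j \<Longrightarrow> j < 3 * k \<Longrightarrow> s \<in> {0, 2, 8} \<Longrightarrow>
      j * (j + (A + B - 1 + s)) \<noteq> k * (k + (3 * A + 7 - B))"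
    and "B \<le> 3 * A + 7"
  shows "transmission_irregular (X_tree (A + 4) (A + 3) A B)"
proof -
  define c where "c = A + B - 1"
  have c: "A + B = c + 1" using assms(1) by (simp add: c_def)
  let ?As = "[A + 4, A + 3, A, B]"
  have offsets: "sum_list ?As - 2 * (A + 4) = c" "sum_list ?As - 2 * (A + 3) = c + 2"
    "sum_list ?As - 2 * A = c + 8" "sum_list ?As - 2 * B = 3 * A + 7 - B"
    using c by auto
  have branches: "?As ! 0 = A + 4" "?As ! 1 = A + 3" "?As ! 2 = A" "?As ! 3 = B"
    by simp_all
  have short': "j * (j + (c + s)) \<noteq> k * (k + (3 * A + 7 - B))"
    if "j > 0" "k \<in> {1..B}" "s \<in> {0, 2, 8}" for j k s
  proof (cases "j < 3 * k")
    case True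
    then show ?thesis using short that unfolding c_def by blast
  next
    case False
    \<comment> \<open>The offset is \<open>3 * c + 10 - 4 * B\<close>, and \<open>10 < 8 * k + 4 * B\<close>.\<close>
    have "k * (k + (3 * A + 7 - B)) < k * (3 * (3 * k + c))"
      using that c assms(2) by (intro mult_strict_left_mono) auto
    also have "\<dots> = (3 * k) * (3 * k + c)" by simp
    also have "\<dots> \<le> j * (j + (c + s))"
      using False by (intro mult_mono) auto
    finally show ?thesis by simp
  qed
  have 12: "j * (j + c) \<noteq> k * (k + (c + 2))" if "0 < j" for j k
    using equal_offsets_cases[of 1 j c k] that by fastforce
  have 13: "j * (j + c) \<noteq> k * (k + (c + 8))" if j: "j \<in> {1..A + 4}" for j k
  proof
    assume "j * (j + c) = k * (k + (c + 8))"
    then have "j * (j + c) = k * (k + (c + 2 * 4))" by simp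
    then obtain q where q: "0 < q" "q < 4" "k + 4 = j + q" "q * (j + k + c + 4) = 4 * (c + 4)"
      by (rule equal_offsets_cases[of 4 j c k, rotated 2]) (use j in auto)
    obtain u where u: "A + B = 4 * u" using assms(3) by (auto elim: dvdE)
    consider "q = 1" | "q = 2" | "q = 3" using q by linarith
    then show False
    proof cases
      \<comment> \<open>Here \<open>2 * j = 3 * c + 15\<close>, but \<open>j \<le> A + 4 \<le> c + 4\<close>.\<close>
      case 1
      then show ?thesis using q c assms(2) j by simp
    next
      \<comment> \<open>Here \<open>j - k = 2\<close>, while \<open>j + k = c + 4\<close> is odd.\<close>
      case 2
      then show ?thesis using q c u by simp presburger
    next
      \<comment> \<open>Here \<open>3 * (j + k) = c + 4 = A + B + 3\<close>.\<close>
      case 3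
      then show ?thesis using q c assms(4) by simp presburger
    qed
  qed
  have 23: "j * (j + (c + 2)) \<noteq> k * (k + (c + 8))" if j: "j \<in> {1..A + 3}" for j k
  proof
    assume "j * (j + (c + 2)) = k * (k + (c + 8))"
    then have "j * (j + (c + 2)) = k * (k + ((c + 2) + 2 * 3))" by simp
    then obtain q where q: "0 < q" "q < 3" "k + 3 = j + q"
      "q * (j + k + (c + 2) + 3) = 3 * (c + 2 + 3)"
      by (rule equal_offsets_cases[of 3 j "c + 2" k, rotated 2]) (use j in auto)
    obtain u where u: "A + B = 4 * u" using assms(3) by (auto elim: dvdE)
    consider "q = 1" | "q = 2" using q by linarith
    then show False
    proof cases
      \<comment> \<open>Here \<open>j = c + 6\<close>, but \<open>j \<le> A + 3 \<le> c + 3\<close>.\<close>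
      case 1
      then show ?thesis using q c assms(2) j by simp
    next
      \<comment> \<open>Here \<open>j - k = 1\<close>, while \<open>j + k = (c + 5) / 2 = 2 * u + 2\<close> is even.\<close>
      case 2
      then show ?thesis using q c u by simp presburger
    qed
  qed
  show ?thesis
    unfolding X_tree_def
  proof (rule transmission_irregular_starlike_treeI)
    fix i assume "i < length ?As"
    then have "i = 0 \<or> i = 1 \<or> i = 2 \<or> i = 3" by auto
    then show "2 * ?As ! i \<le> sum_list ?As"
      using assms by auto
  next
    fix i i' j k
    assume "i < i'" "i' < length ?As" and jk: "j \<in> {1..?As ! i}" "k \<in> {1..?As ! i'}"
    then have "i' < 4" by simp
    then have "i' = 1 \<and> i = 0 \<or> i' = 2 \<and> (i = 0 \<or> i = 1) \<or>
        i' = 3 \<and> (i = 0 \<or> i = 1 \<or> i = 2)"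
      using \<open>i < i'\<close> by presburger
    then consider "i = 0" "i' = 1" | "i = 0" "i' = 2" | "i = 1" "i' = 2"
      | "i = 0" "i' = 3" | "i = 1" "i' = 3" | "i = 2" "i' = 3"
      by blast
    then show "j * (j + (sum_list ?As - 2 * ?As ! i)) \<noteq> k * (k + (sum_list ?As - 2 * ?As ! i'))"
    proof cases
      case 1
      show ?thesis
        using jk unfolding 1 branches offsets by (intro 12) auto
    next
      case 2
      show ?thesis
        using jk unfolding 2 branches offsets by (intro 13) auto
    next
      case 3
      show ?thesis
        using jk unfolding 3 branches offsets by (intro 23) auto
    next
      case 4
      show ?thesis
        using jk unfolding 4 branches offsets
        by (intro short'[where s = 0, unfolded add_0_right]) auto
    next
      case 5
      show ?thesis
        using jk unfolding 5 branches offsets by (intro short') auto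
    next
      case 6
      show ?thesis
        using jk unfolding 6 branches offsets by (intro short') auto
    qed
  qed simp
qed

text \<open>
  For fixed \<open>r\<close>, \<open>B\<close>, \<open>k\<close>, \<open>j\<close> and \<open>s\<close> both sides are linear in \<open>t\<close>. The factor \<open>12\<close> matters here:
  with an arbitrary \<open>m\<close> in place of \<open>12 * t\<close> there are solutions, for instance \<open>m = 10\<close> for
  \<open>(r, B) = (3, 1)\<close>, \<open>j = 2\<close>, \<open>k = 1\<close>, \<open>s = 8\<close>, or \<open>m = 18\<close> for \<open>(r, B) = (5, 3)\<close>, \<open>j = 5\<close>,
  \<open>k = 2\<close>, \<open>s = 0\<close>.
\<close>

lemma short_branch_distinct:
  fixes j k r s t B :: nat
  assumes "(r, B) \<in> {(3, 1), (5, 3), (6, 2), (7, 1)}"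
    and "k \<in> {1..B}" "0 < j" "j < 3 * k" "s \<in> {0, 2, 8}"
  shows "j * (j + (r + 12 * t + B - 1 + s)) \<noteq> k * (k + (3 * (r + 12 * t) + 7 - B))"
proof -
  have k: "k = 1 \<or> k = 2 \<or> k = 3"
    using assms(1,2) by auto
  have "j = 1 \<or> j = 2 \<or> j = 3 \<or> j = 4 \<or> j = 5 \<or> j = 6 \<or> j = 7 \<or> j = 8"
    using k assms(3,4) by presburger
  then show ?thesis
    using assms(1,2,4,5) k
    by (simp only: insert_iff empty_iff simp_thms prod.inject)
      (elim disjE conjE, simp_all, presburger+)
qed

theorem theorem8:
  fixes t :: nat
  shows "transmission_irregular (X_tree (7 + 12 * t) (6 + 12 * t) (3 + 12 * t) 1) \<and>
    transmission_irregular (X_tree (9 + 12 * t) (8 + 12 * t) (5 + 12 * t) 3) \<and>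
    transmission_irregular (X_tree (10 + 12 * t) (9 + 12 * t) (6 + 12 * t) 2) \<and>
    transmission_irregular (X_tree (11 + 12 * t) (10 + 12 * t) (7 + 12 * t) 1)"
proof -
  have irregular: "transmission_irregular (X_tree (r + 12 * t + 4) (r + 12 * t + 3) (r + 12 * t) B)"
    if rB: "(r, B) \<in> {(3, 1), (5, 3), (6, 2), (7, 1)}" for r B
  proof (rule transmission_irregular_X_treeI)
    show "\<not> 3 dvd r + 12 * t + B"
      using rB by (auto, presburger+)
  next
    fix j k s :: nat
    assume "k \<in> {1..B}" "0 < j" "j < 3 * k" "s \<in> {0, 2, 8}"
    then show "j * (j + (r + 12 * t + B - 1 + s)) \<noteq> k * (k + (3 * (r + 12 * t) + 7 - B))"
      by (rule short_branch_distinct[OF rB])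
  qed (use rB in auto)
  show ?thesis
    using irregular[of 3 1] irregular[of 5 3] irregular[of 6 2] irregular[of 7 1] by simp
qed

end
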